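(* Let $A$ be a $v$-domain with quotient field $F \neq A$. Then $A$ has at most one strongly irredundant representation.
   Context: For an ideal $I$ of a domain $A$ with quotient field $F$, $I_v = (A :_F (A :_F I))$, where $(A:_F I) = \{q \in F : qI \subseteq A\}$. The domain $A$ is a $v$-domain if it is integrally closed and whenever $I, J, K$ are nonzero ideals of $A$ with $K$ finitely generated and $(IK)_v = (JK)_v$, then $I_v = J_v$ (equivalently, $(I(A:_F I))_v = A$ for every nonzero finitely generated ideal $I$). $\mathfrak X$ denotes the set of valuation rings with quotient field $F$ containing $A$ (including $F$). A representation of $A$ is a subset $Y \subseteq \mathfrak X$ with $A = \bigcap_{V \in Y} V$ (an empty intersection is $F$). A member $V$ of a representation $Y$ is irredundant in $Y$ if $Y\setminus\{V\}$ is not a representation of $A$; it is strongly irredundant in $Y$ if it is irredundant in $Y$ and there is no $W \in \mathfrak X$ with $V \subsetneq W$ such that $(Y \setminus \{V\}) \cup \{W\}$ is a representation of $A$. A representation is strongly irredundant if each of its members is strongly irredundant in it. *)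

theory Defs
  imports "HOL-Algebra.Polynomials" "HOL-Algebra.Ideal_Product"
begin

text \<open>Throughout, a domain \<open>A\<close> is a subset of the carrier of an ambient field \<open>F\<close>; as a ring in its
  own right it is \<open>F\<lparr>carrier := A\<rparr>\<close>.\<close>

definition is_quotient_field :: "('a, 'b) ring_scheme \<Rightarrow> 'a set \<Rightarrow> bool" where
  "is_quotient_field F A \<longleftrightarrow> field F \<and> subdomain A F \<and>
     carrier F = {a \<otimes>\<^bsub>F\<^esub> inv\<^bsub>F\<^esub> b | a b. a \<in> A \<and> b \<in> A \<and> b \<noteq> \<zero>\<^bsub>F\<^esub>}"

definition integral_over :: "('a, 'b) ring_scheme \<Rightarrow> 'a set \<Rightarrow> 'a \<Rightarrow> bool" where
  "integral_over F A x \<longleftrightarrow>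
     (\<exists>p. polynomial\<^bsub>F\<^esub> A p \<and> p \<noteq> [] \<and> lead_coeff p = \<one>\<^bsub>F\<^esub> \<and> ring.eval F p x = \<zero>\<^bsub>F\<^esub>)"

text \<open>Integrally closed in \<open>F\<close>, which is meant to be the quotient field of \<open>A\<close>.\<close>

definition integrally_closed :: "('a, 'b) ring_scheme \<Rightarrow> 'a set \<Rightarrow> bool" where
  "integrally_closed F A \<longleftrightarrow> (\<forall>x \<in> carrier F. integral_over F A x \<longrightarrow> x \<in> A)"

definition colon :: "('a, 'b) ring_scheme \<Rightarrow> 'a set \<Rightarrow> 'a set \<Rightarrow> 'a set" where
  "colon F A I = {q \<in> carrier F. \<forall>x \<in> I. q \<otimes>\<^bsub>F\<^esub> x \<in> A}"

definition v_closure :: "('a, 'b) ring_scheme \<Rightarrow> 'a set \<Rightarrow> 'a set \<Rightarrow> 'a set" where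
  "v_closure F A I = colon F A (colon F A I)"

definition nonzero_ideal :: "('a, 'b) ring_scheme \<Rightarrow> 'a set \<Rightarrow> bool" where
  "nonzero_ideal R I \<longleftrightarrow> ideal I R \<and> I \<noteq> {\<zero>\<^bsub>R\<^esub>}"

definition fin_gen_ideal :: "('a, 'b) ring_scheme \<Rightarrow> 'a set \<Rightarrow> bool" where
  "fin_gen_ideal R I \<longleftrightarrow> (\<exists>S. finite S \<and> S \<subseteq> carrier R \<and> I = genideal R S)"

definition v_domain :: "('a, 'b) ring_scheme \<Rightarrow> 'a set \<Rightarrow> bool" where
  "v_domain F A \<longleftrightarrow> is_quotient_field F A \<and> integrally_closed F A \<and>
     (\<forall>I J K.
        nonzero_ideal (F\<lparr>carrier := A\<rparr>) I \<and> nonzero_ideal (F\<lparr>carrier := A\<rparr>) J \<and>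
        nonzero_ideal (F\<lparr>carrier := A\<rparr>) K \<and> fin_gen_ideal (F\<lparr>carrier := A\<rparr>) K \<and>
        v_closure F A (ideal_prod (F\<lparr>carrier := A\<rparr>) I K) =
          v_closure F A (ideal_prod (F\<lparr>carrier := A\<rparr>) J K) \<longrightarrow>
        v_closure F A I = v_closure F A J)"

text \<open>A valuation ring with quotient field \<open>F\<close>. That \<open>F\<close> is its quotient field follows from the
  second condition; \<open>F\<close> itself qualifies.\<close>

definition valuation_ring_of :: "('a, 'b) ring_scheme \<Rightarrow> 'a set \<Rightarrow> bool" where
  "valuation_ring_of F V \<longleftrightarrow> subdomain V F \<and>
     (\<forall>x \<in> carrier F. x \<noteq> \<zero>\<^bsub>F\<^esub> \<longrightarrow> x \<in> V \<or> inv\<^bsub>F\<^esub> x \<in> V)"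

definition valuation_overrings :: "('a, 'b) ring_scheme \<Rightarrow> 'a set \<Rightarrow> 'a set set" where
  "valuation_overrings F A = {V. valuation_ring_of F V \<and> A \<subseteq> V}"

text \<open>The intersection is taken inside \<open>carrier F\<close>, so that the empty one is \<open>F\<close>.\<close>

definition is_representation :: "('a, 'b) ring_scheme \<Rightarrow> 'a set \<Rightarrow> 'a set set \<Rightarrow> bool" where
  "is_representation F A Y \<longleftrightarrow> Y \<subseteq> valuation_overrings F A \<and> A = carrier F \<inter> \<Inter>Y"

definition irredundant_in :: "('a, 'b) ring_scheme \<Rightarrow> 'a set \<Rightarrow> 'a set set \<Rightarrow> 'a set \<Rightarrow> bool" where
  "irredundant_in F A Y V \<longleftrightarrow> V \<in> Y \<and> \<not> is_representation F A (Y - {V})"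

definition strongly_irredundant_in ::
    "('a, 'b) ring_scheme \<Rightarrow> 'a set \<Rightarrow> 'a set set \<Rightarrow> 'a set \<Rightarrow> bool" where
  "strongly_irredundant_in F A Y V \<longleftrightarrow> irredundant_in F A Y V \<and>
     \<not> (\<exists>W \<in> valuation_overrings F A. V \<subset> W \<and> is_representation F A ((Y - {V}) \<union> {W}))"

definition strongly_irredundant_representation ::
    "('a, 'b) ring_scheme \<Rightarrow> 'a set \<Rightarrow> 'a set set \<Rightarrow> bool" where
  "strongly_irredundant_representation F A Y \<longleftrightarrow>
     is_representation F A Y \<and> (\<forall>V \<in> Y. strongly_irredundant_in F A Y V)"

end

theory Submission
  imports Defs
begin

text \<open>
  Call a valuation overring \<open>W\<close> of \<open>A\<close> a \<open>v\<close>-valuation if \<open>I\<^sub>v \<subseteq> I W\<close> for every finitely generated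
  \<open>I\<close>. Cancellation, applied to ideals with two generators, makes the \<open>v\<close>-operation respect the
  axioms of a valuation, and Zorn's lemma then shows that \<open>A\<close> is the intersection of its
  \<open>v\<close>-valuations. On the other hand, if \<open>Y\<close> represents \<open>A\<close> and \<open>V \<in> Y\<close>, then every
  \<open>v\<close>-valuation contains \<open>V\<close> or the intersection of \<open>Y - {V}\<close>. Hence a strongly irredundant \<open>V\<close> is
  the intersection of the \<open>v\<close>-valuations above it, so it is one itself, and it is minimal among
  them. If \<open>V\<close> were missing from a second strongly irredundant representation \<open>Y2\<close>, then no
  member of \<open>Y2\<close> could contain \<open>V\<close>, so all of them would contain the intersection of \<open>Y - {V}\<close>,
  which is strictly larger than \<open>A\<close>.
\<close>

section \<open>Inverses and valuation rings in a field\<close>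

lemma (in field) nonzero_inv:
  assumes "x \<in> carrier R" "x \<noteq> \<zero>"
  shows "inv x \<in> carrier R" "inv x \<noteq> \<zero>" "x \<otimes> inv x = \<one>" "inv x \<otimes> x = \<one>" "inv (inv x) = x"
proof -
  have U: "x \<in> Units R"
    using assms field_Units by auto
  show "inv x \<in> carrier R" "x \<otimes> inv x = \<one>" "inv x \<otimes> x = \<one>" "inv (inv x) = x"
    using U by auto
  show "inv x \<noteq> \<zero>"
    using Units_inv_Units[OF U] field_Units by auto
qed

lemma (in field) inv_mult_nonzero:
  assumes "x \<in> carrier R" "x \<noteq> \<zero>" "y \<in> carrier R" "y \<noteq> \<zero>"
  shows "inv (x \<otimes> y) = inv x \<otimes> inv y"
proof (rule comm_inv_char)
  show "x \<otimes> y \<otimes> (inv x \<otimes> inv y) = \<one>"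
    using assms nonzero_inv[of x] nonzero_inv[of y]
    by (smt (verit) m_assoc m_comm m_closed r_one)
qed (use assms nonzero_inv in auto)

lemma (in field) valuation_overring_mono:
  assumes "V \<in> valuation_overrings R A" "V \<subseteq> W" "subring W R"
  shows "W \<in> valuation_overrings R A"
  using assms subdomainI' unfolding valuation_overrings_def valuation_ring_of_def by blast

text \<open>If \<open>x \<in> V - W\<close> and \<open>y \<in> W - V\<close>, then \<open>x / y\<close> and \<open>y / x\<close> both lie outside \<open>U\<close>.\<close>

lemma (in field) valuation_overrings_chain:
  assumes U: "valuation_ring_of R U" and V: "subring V R" "U \<subseteq> V" and W: "subring W R" "U \<subseteq> W"
  shows "V \<subseteq> W \<or> W \<subseteq> V"
proof (rule ccontr)
  assume "\<not> (V \<subseteq> W \<or> W \<subseteq> V)"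
  then obtain x y where x: "x \<in> V" "x \<notin> W" and y: "y \<in> W" "y \<notin> V"
    by blast
  have c: "x \<in> carrier R" "y \<in> carrier R" "x \<noteq> \<zero>" "y \<noteq> \<zero>"
    using x y subringE(1,2)[OF V(1)] subringE(1,2)[OF W(1)] by auto
  note ix = nonzero_inv[OF c(1,3)] and iy = nonzero_inv[OF c(2,4)]
  have "x = x \<otimes> inv y \<otimes> y"
    using c iy by (simp add: m_assoc)
  then have 1: "x \<otimes> inv y \<notin> U"
    using x y W subringE(6)[OF W(1)] by (metis subsetD)
  have "inv (x \<otimes> inv y) \<otimes> x = y \<otimes> (x \<otimes> inv x)"
    using c ix(1) iy(1,5) inv_mult_nonzero[OF c(1,3) iy(1,2)] by (simp add: m_ac)
  then have "y = inv (x \<otimes> inv y) \<otimes> x"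
    using c ix by simp
  then have "inv (x \<otimes> inv y) \<notin> U"
    using x y V subringE(6)[OF V(1)] by (metis subsetD)
  moreover have "x \<otimes> inv y \<in> carrier R" "x \<otimes> inv y \<noteq> \<zero>"
    using c iy integral by blast+
  ultimately show False
    using 1 U unfolding valuation_ring_of_def by blast
qed

text \<open>Of two comparable sets, the smaller avoids whatever either of them avoids, so one member
  of the chain can serve all of \<open>T\<close>. This later passes a condition on finite sets to
  the intersection of a chain of valuation rings.\<close>

lemma finite_chain_avoid:
  assumes "finite T" "\<C> \<noteq> {}" "\<And>V W. V \<in> \<C> \<Longrightarrow> W \<in> \<C> \<Longrightarrow> V \<subseteq> W \<or> W \<subseteq> V"
    and "\<And>t. t \<in> T \<Longrightarrow> \<exists>W\<in>\<C>. t \<notin> W"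
  shows "\<exists>W\<in>\<C>. T \<inter> W = {}"
  using assms(1,4)
proof (induction T rule: finite_induct)
  case empty
  then show ?case using assms(2) by blast
next
  case (insert t T)
  then obtain V W where "V \<in> \<C>" "T \<inter> V = {}" "W \<in> \<C>" "t \<notin> W"
    by (metis insertCI)
  then show ?case
    using assms(3)[of V W] by blast
qed

section \<open>Colon ideals and cancellation in a v-domain\<close>

locale v_domain_in_field = field F for F :: "('a, 'b) ring_scheme" (structure) +
  fixes A :: "'a set"
  assumes v_domain: "v_domain F A"
begin

lemma A_subdomain: "subdomain A F"
  using v_domain unfolding v_domain_def is_quotient_field_def by blast

lemmas A_carrier = subsetD[OF subdomainE(1)[OF A_subdomain]]
  and A_simps [simp] = subdomainE(2,3)[OF A_subdomain]
  and A_mult = subdomainE(6)[OF A_subdomain]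
  and A_add = subdomainE(7)[OF A_subdomain]

lemma A_ring: "ring (F\<lparr>carrier := A\<rparr>)"
  by (rule cring.axioms(1)[OF domain.axioms(1)[OF subdomain_is_domain[OF A_subdomain]]])

lemma fraction:
  assumes "x \<in> carrier F"
  obtains a b where "a \<in> A" "b \<in> A" "b \<noteq> \<zero>" "x = a \<otimes> inv b"
  using assms v_domain unfolding v_domain_def is_quotient_field_def by blast

lemma genideal_subset:
  assumes "S \<subseteq> A"
  shows "genideal (F\<lparr>carrier := A\<rparr>) S \<subseteq> A"
proof -
  interpret R: ring "F\<lparr>carrier := A\<rparr>" by (rule A_ring)
  show ?thesis
    using R.genideal_minimal[OF R.oneideal, of S] assms by simp
qed

text \<open>The elements of \<open>A\<close> that a fixed \<open>y\<close> multiplies into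
  \<open>A\<close> form an ideal, which contains the generated ideal as soon as it contains
  \<open>S\<close>. Colons can thus be computed on generators.\<close>

lemma colon_genideal:
  assumes S: "S \<subseteq> A"
  shows "colon F A (genideal (F\<lparr>carrier := A\<rparr>) S) = colon F A S"
proof -
  let ?R = "F\<lparr>carrier := A\<rparr>"
  interpret R: ring ?R by (rule A_ring)
  have "S \<subseteq> genideal ?R S"
    using R.genideal_self[of S] S by simp
  moreover have "y \<otimes> x \<in> A" if y: "y \<in> colon F A S" and x: "x \<in> genideal ?R S" for x y
  proof -
    have yF: "y \<in> carrier F"
      using y by (simp add: colon_def)
    let ?I = "{x \<in> A. y \<otimes> x \<in> A}"
    have cl: "a \<otimes> z \<in> ?I" if "z \<in> ?I" "a \<in> A" for a z
    proof -
      have "y \<otimes> (a \<otimes> z) = a \<otimes> (y \<otimes> z)"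
        using that yF A_carrier by (simp add: m_lcomm)
      then show ?thesis using that A_mult by auto
    qed
    have "ideal ?I ?R"
    proof (rule idealI[OF A_ring])
      show "subgroup ?I (add_monoid ?R)"
      proof (rule R.add.subgroupI)
        show "?I \<subseteq> carrier ?R" by auto
        have "\<zero> \<in> ?I" using yF by simp
        then show "?I \<noteq> {}" by blast
        show "a \<oplus>\<^bsub>?R\<^esub> b \<in> ?I" if "a \<in> ?I" "b \<in> ?I" for a b
          using that yF A_carrier A_add by (auto simp: r_distr)
        fix a assume a: "a \<in> ?I"
        have m: "\<ominus>\<^bsub>?R\<^esub> \<one>\<^bsub>?R\<^esub> \<in> A"
          using R.a_inv_closed[of "\<one>\<^bsub>?R\<^esub>"] R.one_closed by simp
        have "\<ominus>\<^bsub>?R\<^esub> a = \<ominus>\<^bsub>?R\<^esub> \<one>\<^bsub>?R\<^esub> \<otimes>\<^bsub>?R\<^esub> a"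
          using R.l_minus[of "\<one>\<^bsub>?R\<^esub>" a] R.l_one[of a] R.one_closed a by simp
        then show "\<ominus>\<^bsub>?R\<^esub> a \<in> ?I"
          using cl[OF a m] by simp
      qed
      show "x \<otimes>\<^bsub>?R\<^esub> a \<in> ?I" if "a \<in> ?I" "x \<in> carrier ?R" for a x
        using cl[of a x] that by simp
      show "a \<otimes>\<^bsub>?R\<^esub> x \<in> ?I" if "a \<in> ?I" "x \<in> carrier ?R" for a x
        using cl[of a x] that A_carrier m_comm[of a x] by simp
    qed
    moreover have "S \<subseteq> ?I"
      using S y by (auto simp: colon_def)
    ultimately show ?thesis
      using R.genideal_minimal x by blast
  qed
  ultimately show ?thesis
    unfolding colon_def by blast
qed

lemma colon_ideal_prod:
  assumes "I \<subseteq> A" "K \<subseteq> A"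
  shows "colon F A (ideal_prod (F\<lparr>carrier := A\<rparr>) I K) =
    {y \<in> carrier F. \<forall>i\<in>I. y \<otimes> i \<in> colon F A K}" (is "?L = ?R")
proof (intro equalityI subsetI)
  fix y assume y: "y \<in> ?L"
  then have yF: "y \<in> carrier F" by (simp add: colon_def)
  have "y \<otimes> i \<otimes> k \<in> A" if "i \<in> I" "k \<in> K" for i k
  proof -
    have "i \<in> carrier F" "k \<in> carrier F" using that assms A_carrier by auto
    moreover have "y \<otimes> (i \<otimes> k) \<in> A"
      using y ideal_prod.prod[OF that, of "F\<lparr>carrier := A\<rparr>"] by (simp add: colon_def)
    ultimately show ?thesis using yF by (simp add: m_assoc)
  qed
  then show "y \<in> ?R"
    using yF assms A_carrier by (auto simp: colon_def)
next
  fix y assume y: "y \<in> ?R"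
  then have yF: "y \<in> carrier F" by blast
  \<comment> \<open>Membership in \<open>A\<close> is carried through the induction because
    distributivity in the sum case needs the summands in \<open>carrier F\<close>.\<close>
  have "s \<in> A \<and> y \<otimes> s \<in> A" if "s \<in> ideal_prod (F\<lparr>carrier := A\<rparr>) I K" for s
    using that
  proof (induction rule: ideal_prod.induct)
    case (prod i k)
    then have "y \<otimes> i \<otimes> k \<in> A" "i \<in> A" "k \<in> A"
      using y assms by (auto simp: colon_def)
    then show ?case
      using A_mult yF A_carrier by (simp add: m_assoc)
  next
    case (sum s t)
    then show ?case
      using A_add yF A_carrier by (simp add: r_distr)
  qed
  then show "y \<in> ?L"
    using yF by (auto simp: colon_def)
qed

lemma nonzero_genideal:
  assumes "S \<subseteq> A" "s \<in> S" "s \<noteq> \<zero>"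
  shows "nonzero_ideal (F\<lparr>carrier := A\<rparr>) (genideal (F\<lparr>carrier := A\<rparr>) S)"
proof -
  interpret R: ring "F\<lparr>carrier := A\<rparr>" by (rule A_ring)
  show ?thesis
    using R.genideal_ideal[of S] R.genideal_self[of S] assms
    unfolding nonzero_ideal_def by auto
qed

text \<open>The one place where cancellation enters. Write \<open>q\<close> as \<open>r\<close> over
  \<open>e\<close>. Stability makes the products of \<open>(r, e)\<close> and of \<open>(e)\<close>
  with \<open>(u, w)\<close> have the same colon. Cancelling \<open>(u, w)\<close> leaves equal
  \<open>v\<close>-closures of \<open>(r, e)\<close> and \<open>(e)\<close>, so \<open>e\<close>
  divides \<open>r\<close> in \<open>A\<close>.\<close>

lemma colon_stabilizer_integral:
  assumes u: "u \<in> A" "u \<noteq> \<zero>" and w: "w \<in> A" and q: "q \<in> carrier F"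
    and stab: "\<And>y. y \<in> colon F A {u, w} \<Longrightarrow> q \<otimes> y \<in> colon F A {u, w}"
  shows "q \<in> A"
proof -
  let ?R = "F\<lparr>carrier := A\<rparr>"
  obtain r e where r: "r \<in> A" and e: "e \<in> A" "e \<noteq> \<zero>" and qe: "q = r \<otimes> inv e"
    using fraction[OF q] by blast
  have rc: "r \<in> carrier F" "e \<in> carrier F"
    using r e A_carrier by auto
  note ie = nonzero_inv[OF rc(2) e(2)]
  have rq: "r = q \<otimes> e"
    using rc ie by (simp add: qe m_assoc)
  let ?I = "genideal ?R {r, e}" and ?J = "genideal ?R {e}" and ?K = "genideal ?R {u, w}"
  have sub: "?I \<subseteq> A" "?J \<subseteq> A" "?K \<subseteq> A"
    by (rule genideal_subset; use r e u w in blast)+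
  have K: "colon F A ?K = colon F A {u, w}"
    by (rule colon_genideal) (use u w in auto)
  have prod: "colon F A (ideal_prod ?R (genideal ?R S) ?K) =
      {y \<in> carrier F. \<forall>i\<in>S. y \<otimes> i \<in> colon F A {u, w}}" if S: "S \<subseteq> A" for S
  proof -
    note SA = genideal_subset[OF S]
    have "(\<forall>i\<in>genideal ?R S. y \<otimes> i \<in> colon F A {u, w}) \<longleftrightarrow> (\<forall>i\<in>S. y \<otimes> i \<in> colon F A {u, w})"
      if y: "y \<in> carrier F" for y
    proof -
      \<comment> \<open>Interchanging the two quantifiers moves \<open>B\<close> inside
        \<open>colon\<close>. Used for the generated ideal and for \<open>S\<close>, it reduces the
        claim to \<open>colon_genideal\<close>.\<close>
      have "(\<forall>i\<in>B. y \<otimes> i \<in> colon F A {u, w}) \<longleftrightarrow> (\<forall>k\<in>{u, w}. y \<otimes> k \<in> colon F A B)"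
        if B: "B \<subseteq> A" for B
      proof -
        have comm: "y \<otimes> i \<otimes> k = y \<otimes> k \<otimes> i" if "i \<in> B" "k \<in> {u, w}" for i k
        proof -
          have "i \<in> carrier F" "k \<in> carrier F" using that B u w A_carrier by auto
          then show ?thesis using y by (simp add: m_ac)
        qed
        have closed: "y \<otimes> i \<in> carrier F" if "i \<in> B \<union> {u, w}" for i
          using that B u w y A_carrier by auto
        have "(\<forall>i\<in>B. y \<otimes> i \<in> colon F A {u, w}) \<longleftrightarrow> (\<forall>i\<in>B. \<forall>k\<in>{u, w}. y \<otimes> i \<otimes> k \<in> A)"
          using closed by (auto simp: colon_def)
        also have "\<dots> \<longleftrightarrow> (\<forall>k\<in>{u, w}. \<forall>i\<in>B. y \<otimes> k \<otimes> i \<in> A)"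
          using comm by metis
        also have "\<dots> \<longleftrightarrow> (\<forall>k\<in>{u, w}. y \<otimes> k \<in> colon F A B)"
          using closed by (auto simp: colon_def)
        finally show ?thesis .
      qed
      from this[OF SA] this[OF S] show ?thesis
        by (simp only: colon_genideal[OF S])
    qed
    then show ?thesis
      unfolding colon_ideal_prod[OF SA sub(3)] K by auto
  qed
  \<comment> \<open>The condition imposed by the generator \<open>r\<close> follows from the one
    imposed by \<open>e\<close>, so adding \<open>r\<close> does not change the colon of the
    product.\<close>
  have "y \<otimes> r \<in> colon F A {u, w}" if "y \<in> carrier F" "y \<otimes> e \<in> colon F A {u, w}" for y
  proof -
    have "y \<otimes> r = q \<otimes> (y \<otimes> e)"
      using that rc q by (simp add: rq m_lcomm)
    then show ?thesis using stab that by simp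
  qed
  then have "colon F A (ideal_prod ?R ?I ?K) = colon F A (ideal_prod ?R ?J ?K)"
    using r e by (auto simp: prod)
  then have "v_closure F A (ideal_prod ?R ?I ?K) = v_closure F A (ideal_prod ?R ?J ?K)"
    by (simp add: v_closure_def)
  moreover have "nonzero_ideal ?R ?I" "nonzero_ideal ?R ?J" "nonzero_ideal ?R ?K"
    using nonzero_genideal[of "{r, e}" e] nonzero_genideal[of "{e}" e]
      nonzero_genideal[of "{u, w}" u] r e u w by auto
  moreover have "fin_gen_ideal ?R ?K"
    unfolding fin_gen_ideal_def using u w by (intro exI[of _ "{u, w}"]) auto
  ultimately have "v_closure F A ?I = v_closure F A ?J"
    using v_domain unfolding v_domain_def by blast
  then have "colon F A (colon F A {r, e}) = colon F A (colon F A {e})"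
    using colon_genideal[of "{r, e}"] colon_genideal[of "{e}"] r e by (simp add: v_closure_def)
  \<comment> \<open>Since \<open>r\<close> also lies in the double colon of \<open>{e}\<close>, it
    multiplies \<open>inv e\<close> into \<open>A\<close>.\<close>
  moreover have "r \<in> colon F A (colon F A {r, e})"
    using rc by (auto simp: colon_def m_comm)
  moreover have "inv e \<in> colon F A {e}"
    using ie by (auto simp: colon_def)
  ultimately show ?thesis
    unfolding qe colon_def by blast
qed

text \<open>A common denominator \<open>d\<close> moves \<open>a\<close> and \<open>b\<close> into
  \<open>A\<close>, and \<open>y\<close> is replaced by \<open>y \<otimes> d\<close>. This
  fractional form yields all the closure properties of unital sets below.\<close>

lemma colon_stabilizer:
  assumes a: "a \<in> carrier F" "a \<noteq> \<zero>" and b: "b \<in> carrier F" and q: "q \<in> carrier F"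
    and stab: "\<And>y. \<lbrakk>y \<in> carrier F; y \<otimes> a \<in> A; y \<otimes> b \<in> A\<rbrakk>
      \<Longrightarrow> q \<otimes> y \<otimes> a \<in> A \<and> q \<otimes> y \<otimes> b \<in> A"
  shows "q \<in> A"
proof -
  obtain a1 a2 where a12: "a1 \<in> A" "a2 \<in> A" "a2 \<noteq> \<zero>" "a = a1 \<otimes> inv a2"
    using fraction[OF a(1)] by blast
  obtain b1 b2 where b12: "b1 \<in> A" "b2 \<in> A" "b2 \<noteq> \<zero>" "b = b1 \<otimes> inv b2"
    using fraction[OF b] by blast
  define d where "d = a2 \<otimes> b2"
  have c: "a1 \<in> carrier F" "a2 \<in> carrier F" "b1 \<in> carrier F" "b2 \<in> carrier F"
    using a12 b12 A_carrier by auto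
  note ia = nonzero_inv[OF c(2) a12(3)] and ib = nonzero_inv[OF c(4) b12(3)]
  have d: "d \<in> carrier F" "d \<noteq> \<zero>"
    unfolding d_def using c a12 b12 integral by blast+
  have "d \<otimes> a = (a2 \<otimes> inv a2) \<otimes> (b2 \<otimes> a1)"
    unfolding d_def a12 using c ia(1) by (simp add: m_ac)
  then have da: "d \<otimes> a \<in> A"
    using c ia A_mult[OF b12(2) a12(1)] by simp
  have "d \<otimes> b = (b2 \<otimes> inv b2) \<otimes> (a2 \<otimes> b1)"
    unfolding d_def b12 using c ib(1) by (simp add: m_ac)
  then have db: "d \<otimes> b \<in> A"
    using c ib A_mult[OF a12(2) b12(1)] by simp
  show ?thesis
  proof (rule colon_stabilizer_integral[of "d \<otimes> a" "d \<otimes> b"])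
    show "d \<otimes> a \<noteq> \<zero>" using integral a d by blast
    fix y assume y: "y \<in> colon F A {d \<otimes> a, d \<otimes> b}"
    then have yF: "y \<in> carrier F" by (simp add: colon_def)
    have "y \<otimes> d \<otimes> a \<in> A" "y \<otimes> d \<otimes> b \<in> A"
      using y yF a b d by (auto simp: colon_def m_assoc)
    then have "q \<otimes> (y \<otimes> d) \<otimes> a \<in> A \<and> q \<otimes> (y \<otimes> d) \<otimes> b \<in> A"
      using stab yF d by simp
    then show "q \<otimes> y \<in> colon F A {d \<otimes> a, d \<otimes> b}"
      using yF a b d q by (auto simp: colon_def m_assoc)
  qed (use da db q in auto)
qed

section \<open>Unital sets\<close>

text \<open>A unital set generates a fractional ideal whose \<open>v\<close>-closure contains \<open>\<one>\<close>.\<close>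

definition unital :: "'a set \<Rightarrow> bool" where
  "unital T \<longleftrightarrow> finite T \<and> T \<subseteq> carrier F - {\<zero>} \<and> colon F A T \<subseteq> A"

lemma unitalD:
  assumes "unital T" "q \<in> carrier F" "\<And>t. t \<in> T \<Longrightarrow> q \<otimes> t \<in> A"
  shows "q \<in> A"
  using assms unfolding unital_def colon_def by blast

lemma unital_mono:
  assumes "unital T" "T \<subseteq> T'" "finite T'" "T' \<subseteq> carrier F - {\<zero>}"
  shows "unital T'"
  using assms unfolding unital_def colon_def by blast

text \<open>Use \<open>colon_stabilizer\<close> for the pair \<open>a\<close>,
  \<open>\<one>\<close>: \<open>qya\<close> is the product of \<open>qa\<close> and
  \<open>y\<close>, and \<open>qy\<close> is the product of \<open>q inv a\<close> and
  \<open>ya\<close>. This will give the dichotomy between \<open>x\<close> and \<open>inv x\<close>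
  in a valuation ring.\<close>

lemma unital_inverse_pair:
  assumes a: "a \<in> carrier F" "a \<noteq> \<zero>"
  shows "unital {a, inv a}"
proof -
  note ia = nonzero_inv[OF a]
  have "q \<in> A" if q: "q \<in> carrier F" "q \<otimes> a \<in> A" "q \<otimes> inv a \<in> A" for q
  proof (rule colon_stabilizer[OF a one_closed q(1)])
    fix y assume y: "y \<in> carrier F" "y \<otimes> a \<in> A" "y \<otimes> \<one> \<in> A"
    have "q \<otimes> y \<otimes> a = (q \<otimes> a) \<otimes> (y \<otimes> \<one>)"
      using q y a by (simp add: m_ac)
    moreover have "q \<otimes> y \<otimes> \<one> = q \<otimes> y \<otimes> (a \<otimes> inv a)"
      by (simp add: ia)
    moreover have "\<dots> = (q \<otimes> inv a) \<otimes> (y \<otimes> a)"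
      using q(1) y(1) a ia(1) by (simp add: m_ac)
    ultimately show "q \<otimes> y \<otimes> a \<in> A \<and> q \<otimes> y \<otimes> \<one> \<in> A"
      using q y A_mult by metis
  qed
  then show ?thesis
    unfolding unital_def colon_def using a ia by auto
qed

text \<open>Use \<open>colon_stabilizer\<close> for the pair \<open>b\<close>,
  \<open>\<one>\<close>. The first hypothesis puts \<open>qyb\<close> into \<open>A\<close>; with
  this, the second puts \<open>qy\<close> into \<open>A\<close>. The lemma will give closure under
  products.\<close>

lemma unital_mult:
  assumes a: "unital (insert a T)" and b: "unital (insert b T)"
  shows "unital (insert (a \<otimes> b) T)"
proof -
  have c: "a \<in> carrier F" "a \<noteq> \<zero>" "b \<in> carrier F" "b \<noteq> \<zero>" "finite T" "T \<subseteq> carrier F - {\<zero>}"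
    using a b unfolding unital_def by auto
  have "q \<in> A" if q: "q \<in> carrier F" "q \<otimes> (a \<otimes> b) \<in> A" and T: "\<forall>t\<in>T. q \<otimes> t \<in> A" for q
  proof (rule colon_stabilizer[OF c(3,4) one_closed q(1)])
    fix y assume y: "y \<in> carrier F" "y \<otimes> b \<in> A" "y \<otimes> \<one> \<in> A"
    have 1: "q \<otimes> y \<otimes> b \<in> A"
    proof (rule unitalD[OF a])
      fix t assume t: "t \<in> insert a T"
      have "q \<otimes> y \<otimes> b \<otimes> a = q \<otimes> (a \<otimes> b) \<otimes> (y \<otimes> \<one>)"
        using q(1) y(1) c(1,3) by (simp add: m_ac)
      moreover have "q \<otimes> y \<otimes> b \<otimes> t = q \<otimes> t \<otimes> (y \<otimes> b)" if "t \<in> carrier F"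
        using q(1) y(1) c(1,3) that by (simp add: m_ac)
      ultimately show "q \<otimes> y \<otimes> b \<otimes> t \<in> A"
        using t T c q y A_mult by auto
    qed (use q y c in auto)
    have "q \<otimes> y \<in> A"
    proof (rule unitalD[OF b])
      fix t assume t: "t \<in> insert b T"
      have "q \<otimes> y \<otimes> t = q \<otimes> t \<otimes> (y \<otimes> \<one>)" if "t \<in> carrier F"
        using q(1) y(1) that by (simp add: m_ac)
      then show "q \<otimes> y \<otimes> t \<in> A"
        using t T c q y A_mult 1 by auto
    qed (use q y in auto)
    then show "q \<otimes> y \<otimes> b \<in> A \<and> q \<otimes> y \<otimes> \<one> \<in> A"
      using 1 q y by simp
  qed
  then show ?thesis
    unfolding unital_def colon_def using c integral by auto
qed

text \<open>Use \<open>colon_stabilizer\<close> for the pair \<open>inv a\<close>,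
  \<open>inv b\<close>. The identity \<open>key\<close> puts \<open>qy inv a inv b\<close> into
  \<open>A\<close>; each hypothesis then handles one of \<open>qy inv b\<close> and
  \<open>qy inv a\<close>. The lemma will give closure under sums.\<close>

lemma unital_inv_add:
  assumes a: "unital (insert (inv a) T)" and b: "unital (insert (inv b) T)"
    and c: "a \<in> carrier F" "a \<noteq> \<zero>" "b \<in> carrier F" "b \<noteq> \<zero>" "a \<oplus> b \<noteq> \<zero>"
  shows "unital (insert (inv (a \<oplus> b)) T)"
proof -
  note ia = nonzero_inv[OF c(1,2)] and ib = nonzero_inv[OF c(3,4)]
  have ab: "a \<oplus> b \<in> carrier F" using c by simp
  note iab = nonzero_inv[OF ab c(5)]
  have T: "finite T" "T \<subseteq> carrier F - {\<zero>}"
    using a unfolding unital_def by auto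
  have "inv (a \<oplus> b) \<otimes> (inv a \<oplus> inv b)
      = inv (a \<oplus> b) \<otimes> (inv a \<otimes> (b \<otimes> inv b) \<oplus> (a \<otimes> inv a) \<otimes> inv b)"
    using ia ib by simp
  also have "\<dots> = inv (a \<oplus> b) \<otimes> (a \<oplus> b) \<otimes> (inv a \<otimes> inv b)"
    using c ia(1) ib(1) iab(1) by (simp add: l_distr r_distr m_ac a_ac)
  finally have key: "inv a \<otimes> inv b = inv (a \<oplus> b) \<otimes> (inv a \<oplus> inv b)"
    using iab ia ib by simp
  have "q \<in> A" if q: "q \<in> carrier F" "q \<otimes> inv (a \<oplus> b) \<in> A" and T': "\<forall>t\<in>T. q \<otimes> t \<in> A" for q
  proof (rule colon_stabilizer[OF ia(1,2) ib(1) q(1)])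
    fix y assume y: "y \<in> carrier F" "y \<otimes> inv a \<in> A" "y \<otimes> inv b \<in> A"
    have "q \<otimes> y \<otimes> (inv a \<otimes> inv b) = q \<otimes> inv (a \<oplus> b) \<otimes> (y \<otimes> inv a \<oplus> y \<otimes> inv b)"
      unfolding key using q(1) y(1) ia(1) ib(1) iab(1) by (simp add: r_distr m_ac)
    then have qy: "q \<otimes> y \<otimes> (inv a \<otimes> inv b) \<in> A"
      using q y A_mult A_add by simp
    have 1: "q \<otimes> y \<otimes> s \<otimes> t \<in> A" if "t \<in> T" "y \<otimes> s \<in> A" "s \<in> carrier F" for s t
    proof -
      have "t \<in> carrier F" using that T by auto
      then have "q \<otimes> y \<otimes> s \<otimes> t = q \<otimes> t \<otimes> (y \<otimes> s)"
        using q(1) y(1) that by (simp add: m_ac)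
      then show ?thesis using that T' A_mult by simp
    qed
    have "q \<otimes> y \<otimes> inv a \<in> A"
    proof (rule unitalD[OF b])
      fix t assume "t \<in> insert (inv b) T"
      moreover have "q \<otimes> y \<otimes> inv a \<otimes> inv b \<in> A"
        using qy q(1) y(1) ia(1) ib(1) by (simp add: m_assoc)
      ultimately show "q \<otimes> y \<otimes> inv a \<otimes> t \<in> A"
        using 1 y ia by auto
    qed (use q y ia in auto)
    moreover have "q \<otimes> y \<otimes> inv b \<in> A"
    proof (rule unitalD[OF a])
      fix t assume "t \<in> insert (inv a) T"
      moreover have "q \<otimes> y \<otimes> inv b \<otimes> inv a \<in> A"
        using qy q(1) y(1) ia(1) ib(1) by (simp add: m_ac)
      ultimately show "q \<otimes> y \<otimes> inv b \<otimes> t \<in> A"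
        using 1 y ib by auto
    qed (use q y ib in auto)
    ultimately show "q \<otimes> y \<otimes> inv a \<in> A \<and> q \<otimes> y \<otimes> inv b \<in> A" ..
  qed
  then show ?thesis
    unfolding unital_def colon_def using T iab by auto
qed

section \<open>Construction of v-valuations\<close>

text \<open>The condition says that the maximal ideal of \<open>W\<close>, whose nonzero elements are the \<open>t\<close> with
  \<open>inv t \<notin> W\<close>, contains no unital set.\<close>

definition v_valuations :: "'a set set" where
  "v_valuations = {W \<in> valuation_overrings F A. \<forall>T. unital T \<longrightarrow> (\<exists>t\<in>T. inv t \<in> W)}"

text \<open>Here \<open>M\<close> becomes the set of nonzero elements of the maximal ideal of
  \<open>?W\<close>. The closure properties of unital sets translate into the axioms of a valuation
  ring.\<close>

lemma v_valuation_of_maximal: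
  assumes M: "M \<subseteq> carrier F - {\<zero>}" "\<And>T. T \<subseteq> M \<Longrightarrow> \<not> unital T"
    and max: "\<And>x. \<lbrakk>x \<in> carrier F; x \<noteq> \<zero>; x \<notin> M\<rbrakk> \<Longrightarrow> \<exists>T\<subseteq>M. unital (insert x T)"
  shows "{a \<in> carrier F. a = \<zero> \<or> inv a \<notin> M} \<in> v_valuations" (is "?W \<in> _")
proof -
  \<comment> \<open>With \<open>memD\<close>: a nonzero \<open>a\<close> lies in \<open>?W\<close>
    exactly when \<open>inv a\<close> completes some subset of \<open>M\<close> to a unital
    set.\<close>
  have memI: "a \<in> ?W" if a: "a \<in> carrier F" "a \<noteq> \<zero>" and T: "T \<subseteq> M" "unital (insert (inv a) T)" for a T
  proof -
    have "inv a \<notin> M"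
      using M(2)[of "insert (inv a) T"] T by auto
    then show ?thesis using a by simp
  qed
  have memD: "\<exists>T\<subseteq>M. finite T \<and> unital (insert (inv a) T)" if "a \<in> ?W" "a \<noteq> \<zero>" for a
    using max[of "inv a"] that nonzero_inv[of a] unfolding unital_def by auto
  \<comment> \<open>The closure lemmas need the same \<open>T\<close> for both elements; the union
    of the two witnesses serves.\<close>
  have common: "\<exists>T\<subseteq>M. unital (insert (inv a) T) \<and> unital (insert (inv b) T)"
    if a: "a \<in> ?W" "a \<noteq> \<zero>" and b: "b \<in> ?W" "b \<noteq> \<zero>" for a b
  proof -
    obtain S T where S: "S \<subseteq> M" "finite S" "unital (insert (inv a) S)"
      and T: "T \<subseteq> M" "finite T" "unital (insert (inv b) T)"
      using memD[OF a] memD[OF b] by metis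
    have "insert (inv a) (S \<union> T) \<subseteq> carrier F - {\<zero>}" "insert (inv b) (S \<union> T) \<subseteq> carrier F - {\<zero>}"
      using S T unfolding unital_def by blast+
    then have "unital (insert (inv a) (S \<union> T))" "unital (insert (inv b) (S \<union> T))"
      using S(2) T(2) unital_mono[OF S(3), of "insert (inv a) (S \<union> T)"]
        unital_mono[OF T(3), of "insert (inv b) (S \<union> T)"] by blast+
    then show ?thesis using S(1) T(1) by (intro exI[of _ "S \<union> T"]) blast
  qed
  have A: "A \<subseteq> ?W"
  proof
    fix a assume a: "a \<in> A"
    show "a \<in> ?W"
    proof (cases "a = \<zero>")
      case False
      have aF: "a \<in> carrier F" using a A_carrier by simp
      note ia = nonzero_inv[OF aF False]
      have "q \<in> A" if "q \<in> carrier F" "q \<otimes> inv a \<in> A" for q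
      proof -
        have "q = q \<otimes> inv a \<otimes> a"
          using that aF ia by (simp add: m_assoc)
        then show ?thesis using A_mult[OF that(2) a] by simp
      qed
      then have "unital {inv a}"
        unfolding unital_def colon_def using ia by auto
      then show ?thesis using memI[of a "{}"] aF False by simp
    qed simp
  qed
  have mult: "a \<otimes> b \<in> ?W" if ab: "a \<in> ?W" "b \<in> ?W" for a b
  proof (cases "a = \<zero> \<or> b = \<zero>")
    case False
    then obtain T where T: "T \<subseteq> M" "unital (insert (inv a) T)" "unital (insert (inv b) T)"
      using common[of a b] ab by blast
    have "a \<otimes> b \<in> carrier F" "a \<otimes> b \<noteq> \<zero>" "inv (a \<otimes> b) = inv a \<otimes> inv b"
      using ab False integral inv_mult_nonzero[of a b] by blast+
    then show ?thesis
      using memI[of "a \<otimes> b", OF _ _ T(1)] unital_mult[OF T(2,3)] by metis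
  qed (use ab in auto)
  have add: "a \<oplus> b \<in> ?W" if ab: "a \<in> ?W" "b \<in> ?W" for a b
  proof (cases "a = \<zero> \<or> b = \<zero> \<or> a \<oplus> b = \<zero>")
    case False
    then obtain T where T: "T \<subseteq> M" "unital (insert (inv a) T)" "unital (insert (inv b) T)"
      using common[of a b] ab by blast
    have "a \<oplus> b \<in> carrier F" using ab by blast
    then show ?thesis
      using memI[OF _ _ T(1)] unital_inv_add[OF T(2,3)] ab False by blast
  qed (use ab in auto)
  have "subring ?W F"
  proof (rule subringI)
    show "\<one> \<in> ?W" using A A_simps by blast
    fix h assume h: "h \<in> ?W"
    have "\<ominus> \<one> \<in> ?W"
      using A subdomainE(5)[OF A_subdomain, of \<one>] A_simps by blast
    from mult[OF this h] show "\<ominus> h \<in> ?W"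
      using h by (simp add: l_minus)
  qed (use mult add in auto)
  moreover have "x \<in> ?W \<or> inv x \<in> ?W" if x: "x \<in> carrier F" "x \<noteq> \<zero>" for x
    using M(2)[of "{x, inv x}"] unital_inverse_pair[OF x] x nonzero_inv[OF x] by auto
  ultimately have "?W \<in> valuation_overrings F A"
    using A subdomainI' unfolding valuation_overrings_def valuation_ring_of_def by blast
  moreover have "\<exists>t\<in>T. inv t \<in> ?W" if T: "unital T" for T
  proof -
    obtain t where t: "t \<in> T" "t \<notin> M" using M(2) T by blast
    then have "t \<in> carrier F" "t \<noteq> \<zero>" using T unfolding unital_def by auto
    then show ?thesis using t nonzero_inv[of t] by (intro bexI[of _ t]) auto
  qed
  ultimately show ?thesis
    unfolding v_valuations_def by blast
qed

text \<open>Zorn's lemma enlarges \<open>{inv x}\<close> to a maximal set without unital subsets. As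
  \<open>inv x\<close> belongs to it, \<open>x\<close> is outside the resulting ring.\<close>

lemma v_valuations_separate:
  assumes x: "x \<in> carrier F" "x \<notin> A"
  shows "\<exists>W\<in>v_valuations. x \<notin> W"
proof -
  have x0: "x \<noteq> \<zero>" using x by auto
  note ix = nonzero_inv[OF x(1) x0]
  define \<M> where "\<M> = {M. inv x \<in> M \<and> M \<subseteq> carrier F - {\<zero>} \<and> (\<forall>T\<subseteq>M. \<not> unital T)}"
  \<comment> \<open>The element \<open>x\<close> multiplies such a \<open>T\<close> into
    \<open>A\<close> without lying in \<open>A\<close>.\<close>
  have "\<not> unital T" if "T \<subseteq> {inv x}" for T
    using unitalD[of T x] x ix that by fastforce
  then have "{inv x} \<in> \<M>"
    unfolding \<M>_def using ix by auto
  then have "\<M> \<noteq> {}" by blast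
  moreover have "\<Union>\<C> \<in> \<M>" if C: "\<C> \<noteq> {}" "subset.chain \<M> \<C>" for \<C>
  proof -
    have CM: "\<C> \<subseteq> \<M>" using C by (simp add: subset_chain_def)
    have "\<not> unital T" if T: "T \<subseteq> \<Union>\<C>" for T
    proof
      assume u: "unital T"
      \<comment> \<open>Finiteness of unital sets is what makes the union of a chain
        admissible.\<close>
      then have "finite T" by (simp add: unital_def)
      then obtain M where "M \<in> \<C>" "T \<subseteq> M"
        using finite_subset_Union_chain[OF _ T C] by blast
      then show False using u CM unfolding \<M>_def by blast
    qed
    then show ?thesis using C CM unfolding \<M>_def by blast
  qed
  ultimately obtain M where M: "M \<in> \<M>" and max: "\<And>N. N \<in> \<M> \<Longrightarrow> M \<subseteq> N \<Longrightarrow> N = M"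
    using subset_Zorn_nonempty[of \<M>] by blast
  have "{a \<in> carrier F. a = \<zero> \<or> inv a \<notin> M} \<in> v_valuations"
  proof (rule v_valuation_of_maximal)
    show "M \<subseteq> carrier F - {\<zero>}" "\<And>T. T \<subseteq> M \<Longrightarrow> \<not> unital T"
      using M unfolding \<M>_def by auto
    fix y assume y: "y \<in> carrier F" "y \<noteq> \<zero>" "y \<notin> M"
    then have "insert y M \<notin> \<M>" using max[of "insert y M"] by blast
    then obtain T where T: "T \<subseteq> insert y M" "unital T"
      using M y unfolding \<M>_def by blast
    then have "insert y (T - {y}) \<subseteq> carrier F - {\<zero>}" "finite (insert y (T - {y}))"
      using y by (auto simp: unital_def)
    then have "unital (insert y (T - {y}))"
      by (intro unital_mono[OF T(2)]) auto
    then show "\<exists>T\<subseteq>M. unital (insert y T)"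
      using T by (intro exI[of _ "T - {y}"]) auto
  qed
  moreover have "inv x \<in> M"
    using M by (simp add: \<M>_def)
  ultimately show ?thesis
    using x0 by (intro bexI) auto
qed

section \<open>Comparison of v-valuations with representations\<close>

text \<open>Suppose \<open>v\<close> and \<open>x\<close> witness the failure of the two inclusions.
  If \<open>q inv v\<close> and \<open>q inv x\<close> lie in \<open>A\<close>, then
  \<open>q\<close> lies in \<open>V\<close> through \<open>v\<close> and in every other member
  through \<open>x\<close>, hence in \<open>A\<close>. So \<open>{inv v, inv x}\<close> is unital,
  and \<open>W\<close> has to contain \<open>v\<close> or \<open>x\<close>.\<close>

lemma v_valuation_dominates:
  assumes Y: "is_representation F A Y" and V: "V \<in> Y" and W: "W \<in> v_valuations"
  shows "V \<subseteq> W \<or> carrier F \<inter> \<Inter>(Y - {V}) \<subseteq> W"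
proof (rule ccontr)
  assume "\<not> ?thesis"
  then obtain v x where v: "v \<in> V" "v \<notin> W" and x: "x \<in> carrier F" "x \<in> \<Inter>(Y - {V})" "x \<notin> W"
    by blast
  have W': "subdomain W F"
    using W unfolding v_valuations_def valuation_overrings_def valuation_ring_of_def by blast
  have rings: "subdomain U F" "A \<subseteq> U" if "U \<in> Y" for U
    using Y that unfolding is_representation_def valuation_overrings_def valuation_ring_of_def by auto
  have vF: "v \<in> carrier F" "v \<noteq> \<zero>" "x \<noteq> \<zero>"
    using v x rings[OF V] subdomainE(1,2) W' by blast+
  note iv = nonzero_inv[OF vF(1,2)] and ix = nonzero_inv[OF x(1) vF(3)]
  have "unital {inv v, inv x}"
  proof -
    have "q \<in> A" if q: "q \<in> carrier F" "q \<otimes> inv v \<in> A" "q \<otimes> inv x \<in> A" for q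
    proof -
      have "q = q \<otimes> inv v \<otimes> v" "q = q \<otimes> inv x \<otimes> x"
        using q(1) vF x(1) iv ix by (simp_all add: m_assoc)
      then have "q \<in> U" if "U \<in> Y" for U
        using rings[OF that] subdomainE(6)[OF rings(1)[OF that]] q v x that
        by (metis DiffI Inter_iff singletonD subsetD)
      then show ?thesis
        using Y q unfolding is_representation_def by blast
    qed
    then show ?thesis
      unfolding unital_def colon_def using iv ix by auto
  qed
  then show False
    using W v x iv ix unfolding v_valuations_def by fastforce
qed

lemma irredundantD:
  assumes Y: "is_representation F A Y" and V: "irredundant_in F A Y V"
  shows "V \<in> Y" "\<not> carrier F \<inter> \<Inter>(Y - {V}) \<subseteq> V" "\<not> carrier F \<inter> \<Inter>(Y - {V}) \<subseteq> A"
proof -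
  show VY: "V \<in> Y" using V by (simp add: irredundant_in_def)
  show *: "\<not> carrier F \<inter> \<Inter>(Y - {V}) \<subseteq> A"
    using Y V unfolding irredundant_in_def is_representation_def by blast
  show "\<not> carrier F \<inter> \<Inter>(Y - {V}) \<subseteq> V"
    using * Y VY unfolding is_representation_def by blast
qed

text \<open>A \<open>U\<close> inside \<open>V\<close> cannot contain the intersection of the other
  members, so domination forces \<open>V \<subseteq> U\<close>.\<close>

lemma irredundant_minimal:
  assumes "is_representation F A Y" "irredundant_in F A Y V" "U \<in> v_valuations" "U \<subseteq> V"
  shows "U = V"
proof -
  have "\<not> carrier F \<inter> \<Inter>(Y - {V}) \<subseteq> U"
    using irredundantD(2)[OF assms(1,2)] assms(4) by (meson order_trans)
  then show ?thesis
    using v_valuation_dominates[OF assms(1) irredundantD(1)[OF assms(1,2)] assms(3)] assms(4)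
    by (meson subset_antisym)
qed

lemma strongly_irredundant_v_valuation:
  assumes Y: "is_representation F A Y" and V: "strongly_irredundant_in F A Y V"
  shows "V \<in> v_valuations"
proof -
  have irr: "irredundant_in F A Y V"
    using V by (simp add: strongly_irredundant_in_def)
  note irrD = irredundantD[OF Y irr]
  have VV: "V \<in> valuation_overrings F A"
    using Y irrD(1) unfolding is_representation_def by blast
  have sub: "subring W F" if "W \<in> valuation_overrings F A" for W
    using that unfolding valuation_overrings_def valuation_ring_of_def
    by (auto dest!: subdomain.axioms(1) subcring.axioms(1))
  define \<C> where "\<C> = {W \<in> v_valuations. V \<subseteq> W}"
  have CV: "W \<in> valuation_overrings F A" if "W \<in> \<C>" for W
    using that unfolding \<C>_def v_valuations_def by blast
  \<comment> \<open>An empty intersection would be the whole type, so this case has to be excluded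
    first; in it, all v-valuations would contain the intersection of \<open>Y - {V}\<close>.\<close>
  have nonempty: "\<C> \<noteq> {}"
  proof
    assume "\<C> = {}"
    then have "carrier F \<inter> \<Inter>(Y - {V}) \<subseteq> W" if "W \<in> v_valuations" for W
      using v_valuation_dominates[OF Y irrD(1) that] that unfolding \<C>_def by blast
    then have "carrier F \<inter> \<Inter>(Y - {V}) \<subseteq> A"
      using v_valuations_separate by blast
    then show False using irrD(3) by blast
  qed
  have "subring (\<Inter>\<C>) F"
    using nonempty sub[OF CV] by (intro subringI) (auto dest: subringE)
  then have WV: "\<Inter>\<C> \<in> valuation_overrings F A"
    using VV valuation_overring_mono[of V A "\<Inter>\<C>"] unfolding \<C>_def by blast
  have "is_representation F A (Y - {V} \<union> {\<Inter>\<C>})"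
  proof -
    \<comment> \<open>A v-valuation that omits \<open>x\<close> cannot contain \<open>V\<close>, so
      by domination it contains the intersection of the other members, and with it
      \<open>x\<close>.\<close>
    have "x \<in> A" if x: "x \<in> carrier F" "x \<in> \<Inter>(Y - {V})" "x \<in> \<Inter>\<C>" for x
    proof (rule ccontr)
      assume "x \<notin> A"
      then obtain W where W: "W \<in> v_valuations" "x \<notin> W"
        using v_valuations_separate[OF x(1)] by blast
      then have "\<not> V \<subseteq> W" using x(3) unfolding \<C>_def by blast
      then show False
        using v_valuation_dominates[OF Y irrD(1) W(1)] x(1,2) W(2) by blast
    qed
    then have "carrier F \<inter> \<Inter>(Y - {V} \<union> {\<Inter>\<C>}) \<subseteq> A" by simp blast
    moreover have Y': "Y - {V} \<union> {\<Inter>\<C>} \<subseteq> valuation_overrings F A"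
      using WV Y unfolding is_representation_def by blast
    moreover have "A \<subseteq> carrier F \<inter> \<Inter>(Y - {V} \<union> {\<Inter>\<C>})"
    proof -
      have "A \<subseteq> U" if "U \<in> Y - {V} \<union> {\<Inter>\<C>}" for U
        using subsetD[OF Y' that] by (simp add: valuation_overrings_def)
      then show ?thesis using A_carrier by (meson Inter_greatest Int_greatest subsetI)
    qed
    ultimately show ?thesis
      unfolding is_representation_def by (intro conjI equalityI)
  qed
  then have "\<not> V \<subset> \<Inter>\<C>"
    using V WV unfolding strongly_irredundant_in_def by metis
  moreover have "V \<subseteq> \<Inter>\<C>"
    unfolding \<C>_def by blast
  ultimately have eq: "V = \<Inter>\<C>"
    by blast
  \<comment> \<open>The members of \<open>\<C>\<close> form a chain, being overrings of the
    valuation ring \<open>V\<close>. If \<open>V\<close> omits all the finitely many inverses, a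
    single member of \<open>\<C>\<close> omits them all, although it is a v-valuation.\<close>
  have "\<exists>t\<in>T. inv t \<in> V" if T: "unital T" for T
  proof (rule ccontr)
    assume *: "\<not> ?thesis"
    have "\<exists>W\<in>\<C>. m_inv F ` T \<inter> W = {}"
    proof (rule finite_chain_avoid[OF _ nonempty])
      show "finite (m_inv F ` T)" using T by (simp add: unital_def)
      show "\<exists>W\<in>\<C>. t \<notin> W" if "t \<in> m_inv F ` T" for t
        using * that eq by blast
      show "U \<subseteq> W \<or> W \<subseteq> U" if "U \<in> \<C>" "W \<in> \<C>" for U W
        using valuation_overrings_chain[of V U W] sub[OF CV] VV that
        unfolding \<C>_def valuation_overrings_def by blast
    qed
    then show False
      using T unfolding \<C>_def v_valuations_def by blast
  qed
  then show ?thesis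
    using VV unfolding v_valuations_def by blast
qed

text \<open>The hypotheses are symmetric, so exchanging \<open>Y1\<close> and \<open>Y2\<close>
  yields equality.\<close>

lemma strongly_irredundant_representation_subset:
  assumes Y1: "strongly_irredundant_representation F A Y1"
    and Y2: "strongly_irredundant_representation F A Y2"
  shows "Y1 \<subseteq> Y2"
proof
  fix V assume V: "V \<in> Y1"
  have rep: "is_representation F A Y1" "is_representation F A Y2"
    and strong: "\<And>W. W \<in> Y1 \<Longrightarrow> strongly_irredundant_in F A Y1 W"
      "\<And>W. W \<in> Y2 \<Longrightarrow> strongly_irredundant_in F A Y2 W"
    using Y1 Y2 unfolding strongly_irredundant_representation_def by auto
  have v: "V \<in> v_valuations"
    using strongly_irredundant_v_valuation[OF rep(1) strong(1)[OF V]] .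
  show "V \<in> Y2"
  proof (rule ccontr)
    assume VY: "V \<notin> Y2"
    have "carrier F \<inter> \<Inter>(Y1 - {V}) \<subseteq> W" if W: "W \<in> Y2" for W
    proof -
      have "irredundant_in F A Y2 W"
        using strong(2)[OF W] by (simp add: strongly_irredundant_in_def)
      \<comment> \<open>A v-valuation inside the irredundant \<open>W\<close> equals
        \<open>W\<close>, which would put \<open>V\<close> into \<open>Y2\<close>.\<close>
      then have "\<not> V \<subseteq> W"
        using irredundant_minimal[OF rep(2) _ v] W VY by blast
      then show ?thesis
        using v_valuation_dominates[OF rep(1) V]
          strongly_irredundant_v_valuation[OF rep(2) strong(2)[OF W]] by blast
    qed
    then have "carrier F \<inter> \<Inter>(Y1 - {V}) \<subseteq> A"
      using rep(2) unfolding is_representation_def by blast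
    then show False
      using irredundantD(3)[OF rep(1)] strong(1)[OF V] by (simp add: strongly_irredundant_in_def)
  qed
qed

end

theorem theorem6p1:
  fixes F :: "('a, 'b) ring_scheme" and A :: "'a set"
  assumes "field F"
    and "subdomain A F"
    and "is_quotient_field F A"
    and "v_domain F A"
    and "carrier F \<noteq> A"
  shows "\<exists>\<^sub>\<le>\<^sub>1 Y. strongly_irredundant_representation F A Y"
proof -
  interpret v_domain_in_field F A
    using assms by (simp add: v_domain_in_field_def v_domain_in_field_axioms_def)
  show ?thesis
    unfolding Uniq_def using strongly_irredundant_representation_subset by blast
qed

end
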